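(* Let $k,n,t$ be positive integers. (1) The sum, over all $\pi\in NC^k_B(n)$, of the number of unordered pairs $\{V,-V\}$ with $V\in\pi$, $V\neq -V$ and $|V|=tk$ equals $nk\binom{n(k+1)-t-1}{nk-1}$. (2) The number of $\pi\in NC^k_B(n)$ having a zero-block of size $2tk$ equals $\binom{n(k+1)-t-1}{nk-1}$.
   Context: For a positive integer $N$ let $[\pm N]=\{1,2,\dots,N,-1,-2,\dots,-N\}$, linearly ordered as $1<2<\dots<N<-1<-2<\dots<-N$ (equivalently, placed clockwise on a circle in this order). A non-crossing partition of type $B_N$ is a partition $\pi$ of $[\pm N]$ that is non-crossing with respect to this order (there are no $a<b<c<d$ with $a,c$ in one block and $b,d$ in a different block), such that for every block $V$ the set $-V=\{-x:x\in V\}$ is also a block, and there is at most one block $V$ with $V=-V$; such a block is called the zero-block. $NC_B(N)$ is the set of these. For positive integers $k,n$, $NC^k_B(n)$ is the set of $\pi\in NC_B(kn)$ all of whose blocks have size divisible by $k$. Binomial coefficients: $\binom{a}{b}=\frac{a!}{b!(a-b)!}$ if $0\le b\le a$ and $0$ otherwise. *)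

theory Defs
  imports Main "HOL-Library.Disjoint_Sets"
begin

definition pmset :: "nat \<Rightarrow> int set" where
  "pmset N = {x. x \<noteq> 0 \<and> \<bar>x\<bar> \<le> int N}"

text \<open>Position in the linear order 1 < 2 < ... < N < -1 < -2 < ... < -N.\<close>
definition posB :: "nat \<Rightarrow> int \<Rightarrow> int" where
  "posB N x = (if x > 0 then x else int N - x)"

definition negset :: "int set \<Rightarrow> int set" where
  "negset V = uminus ` V"

definition noncrossingB :: "nat \<Rightarrow> int set set \<Rightarrow> bool" where
  "noncrossingB N \<pi> \<longleftrightarrow>
     (\<forall>V\<in>\<pi>. \<forall>W\<in>\<pi>. V \<noteq> W \<longrightarrow>
        \<not> (\<exists>a b c d. a \<in> V \<and> c \<in> V \<and> b \<in> W \<and> d \<in> W \<and>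
              posB N a < posB N b \<and> posB N b < posB N c \<and> posB N c < posB N d))"

definition NC_B :: "nat \<Rightarrow> int set set set" where
  "NC_B N = {\<pi>. partition_on (pmset N) \<pi> \<and> noncrossingB N \<pi> \<and>
                 (\<forall>V\<in>\<pi>. negset V \<in> \<pi>) \<and>
                 card {V\<in>\<pi>. negset V = V} \<le> 1}"

definition NC_Bk :: "nat \<Rightarrow> nat \<Rightarrow> int set set set" where
  "NC_Bk k n = {\<pi> \<in> NC_B (k * n). \<forall>V\<in>\<pi>. k dvd card V}"

definition binomZ :: "int \<Rightarrow> int \<Rightarrow> nat" where
  "binomZ a b = (if 0 \<le> b \<and> b \<le> a then nat a choose nat b else 0)"

end

(*
  Unroll the circle to the integers: position x carries the label of x mod 2N, so that negation becomes
  the shift by N. A non-zero block of a non-crossing partition of type B lifts to translates of a finite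
  set that fits into an interval {p..<p + N}. Let f(p) be the size of the block if p is the least element
  of such a lifted block, and f(p) = 0 otherwise; f is N-periodic with sum at most N over a period, and
  the deficit is half the size of the zero-block. Conversely, x belongs to the lifted block that starts
  at the largest p \<le> x with f(p) + ... + f(x) \<ge> x - p + 1, and to the zero-block if there is no such
  p: the walk with steps f(i) - 1 only descends by unit steps, so exactly f(p) positions are assigned
  to p. Hence NC_B(N) corresponds to the sequences of N naturals with sum at most N, the pairs of
  non-zero blocks of size s > 0 correspond to the entries s, and with all entries divided by k both
  counts reduce to counting weak compositions. In part (1), the entry at a marked position is
  exchanged for the slack n - sum, which turns the bounded sums into an exact one.
*)
theory Submission
  imports Defs
begin

subsection \<open>The universal cover of the circle\<close>

text \<open>The residue of a position is one less than the \<open>posB\<close> value of its label,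
  so the linear order of the problem becomes the order of residues modulo
  \<open>2 * N\<close>.\<close>

definition label :: "nat \<Rightarrow> int \<Rightarrow> int" where
  "label N x = (let r = x mod (2 * int N) in if r < int N then r + 1 else int N - r - 1)"

locale circle =
  fixes N :: nat
  assumes N_pos: "0 < N"
begin

abbreviation lab :: "int \<Rightarrow> int" where "lab \<equiv> label N"

lemma mod_bounds: "0 \<le> x mod (2 * int N)" "x mod (2 * int N) < 2 * int N"
  using N_pos by auto

lemma lab_range: "lab x \<in> pmset N"
  using mod_bounds[of x] by (auto simp: label_def pmset_def Let_def)

lemma posB_lab: "posB N (lab x) = x mod (2 * int N) + 1"
  using mod_bounds[of x] by (auto simp: label_def posB_def Let_def)

lemma lab_eq_iff: "lab x = lab y \<longleftrightarrow> x mod (2 * int N) = y mod (2 * int N)"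
proof
  assume "lab x = lab y"
  then show "x mod (2 * int N) = y mod (2 * int N)"
    using posB_lab[of x] posB_lab[of y] by (metis add_right_cancel)
qed (simp add: label_def)

lemma lab_eqE:
  assumes "lab x = lab y"
  obtains i where "y = x + 2 * int N * i"
proof -
  have "2 * int N dvd y - x"
    using assms by (metis lab_eq_iff mod_eq_dvd_iff)
  then show ?thesis using that by (metis add.commute diff_add_cancel dvdE)
qed

lemma lab_periodic [simp]: "lab (x + 2 * int N * i) = lab x"
  by (simp add: lab_eq_iff)

lemma lab_eq_window: "lab x = lab y \<Longrightarrow> \<bar>x - y\<bar> < 2 * int N \<Longrightarrow> x = y"
proof (erule lab_eqE)
  fix i assume *: "\<bar>x - y\<bar> < 2 * int N" "y = x + 2 * int N * i"
  then have "\<bar>2 * int N\<bar> * \<bar>i\<bar> < 2 * int N * 1" by (simp add: abs_mult)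
  then have "i = 0" using N_pos by simp
  then show "x = y" using * by simp
qed

lemma lab_shift: "lab (x + int N) = - lab x"
proof -
  define r where "r = x mod (2 * int N)"
  have r: "0 \<le> r" "r < 2 * int N" using mod_bounds by (auto simp: r_def)
  have "(x + int N) mod (2 * int N) = (r + int N) mod (2 * int N)"
    by (simp add: r_def mod_add_left_eq)
  also have "\<dots> = (if r < int N then r + int N else r - int N)"
  proof (cases "r < int N")
    case False
    have "r + int N = (r - int N) + 2 * int N" by simp
    then have "(r + int N) mod (2 * int N) = (r - int N + 2 * int N) mod (2 * int N)" by (rule arg_cong)
    also have "\<dots> = (r - int N) mod (2 * int N)" by (rule mod_add_self2)
    finally show ?thesis using r False by simp
  qed (use r in \<open>simp add: add.commute\<close>)
  finally show ?thesis using r by (auto simp: label_def r_def[symmetric] Let_def)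
qed

lemma lab_surj:
  assumes "z \<in> pmset N"
  obtains x where "0 \<le> x" "x < 2 * int N" "lab x = z"
proof
  let ?x = "posB N z - 1"
  show 1: "0 \<le> ?x" "?x < 2 * int N" using assms by (auto simp: pmset_def posB_def)
  show "lab ?x = z" using 1 assms
    by (auto simp: label_def Let_def posB_def pmset_def)
qed

lemma range_lab: "range lab = pmset N"
  using lab_range by (auto elim: lab_surj)

lemma finite_pmset: "finite (pmset N)"
proof (rule finite_subset)
  show "pmset N \<subseteq> {- int N..int N}" by (auto simp: pmset_def)
qed simp

lemma card_pmset: "card (pmset N) = 2 * N"
proof -
  have "pmset N = {- int N..int N} - {0}" by (auto simp: pmset_def)
  then show ?thesis by simp
qed

end

subsection \<open>Matching positions by the walk with steps \<open>f i - 1\<close>\<close>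

text \<open>The total size of the blocks that start in \<open>a..b\<close> minus the number of
  positions there. A nonnegative value says that these blocks are large enough to fill the
  interval.\<close>

definition excess :: "(int \<Rightarrow> nat) \<Rightarrow> int \<Rightarrow> int \<Rightarrow> int" where
  "excess f a b = (\<Sum>i=a..b. int (f i) - 1)"

lemma excess_split:
  assumes "a \<le> b + 1" "b \<le> c"
  shows "excess f a c = excess f a b + excess f (b + 1) c"
proof -
  have "{a..c} = {a..b} \<union> {b+1..c}" using assms by auto
  moreover have "{a..b} \<inter> {b+1..c} = {}" by auto
  ultimately show ?thesis unfolding excess_def by (simp add: sum.union_disjoint)
qed

lemma excess_eq: "a \<le> b + 1 \<Longrightarrow> excess f a b = int (\<Sum>i=a..b. f i) - (b - a + 1)"
  by (simp add: excess_def sum_subtractf)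

lemma excess_single [simp]: "excess f a a = int (f a) - 1"
  by (simp add: excess_def)

text \<open>Matching as for nested brackets: the latest start that can still supply position
  \<open>x\<close> wins, so inner blocks are completed before outer ones continue.\<close>

definition opens :: "(int \<Rightarrow> nat) \<Rightarrow> int \<Rightarrow> int \<Rightarrow> bool" where
  "opens f x p \<longleftrightarrow> p \<le> x \<and> 0 \<le> excess f p x \<and> (\<forall>q. p < q \<and> q \<le> x \<longrightarrow> excess f q x < 0)"

text \<open>All positions that no start supplies share the value \<open>None\<close>; together they
  will form the zero-block.\<close>

definition opener :: "(int \<Rightarrow> nat) \<Rightarrow> int \<Rightarrow> int option" where
  "opener f x = (if \<exists>p. opens f x p then Some (THE p. opens f x p) else None)"

lemma opens_unique: "opens f x p \<Longrightarrow> opens f x q \<Longrightarrow> p = q"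
  unfolding opens_def by (meson linorder_less_linear not_less)

lemma opener_Some: "opener f x = Some p \<longleftrightarrow> opens f x p"
  unfolding opener_def by (smt (verit) opens_unique option.inject option.distinct(1) the_equality)

lemma opener_nonneg:
  assumes "p \<le> x" "0 \<le> excess f p x"
  obtains q where "p \<le> q" "opener f x = Some q"
proof
  \<comment> \<open>Only the finitely many starts in \<open>p..x\<close> matter: a maximum among
    them also beats every smaller candidate.\<close>
  let ?A = "{q \<in> {p..x}. 0 \<le> excess f q x}"
  have A: "finite ?A" "p \<in> ?A" using assms by (auto intro: finite_subset[of _ "{p..x}"])
  then show "p \<le> Max ?A" by auto
  have "Max ?A \<in> ?A" using A by (intro Max_in) auto
  moreover have "excess f q x < 0" if "Max ?A < q" "q \<le> x" for q
  proof (rule ccontr)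
    assume "\<not> excess f q x < 0"
    then have "q \<in> ?A" using that \<open>p \<le> Max ?A\<close> by auto
    then show False using Max_ge[OF A(1), of q] that by simp
  qed
  ultimately show "opener f x = Some (Max ?A)" by (auto simp: opener_Some opens_def)
qed

lemma opener_None: "opener f x = None \<longleftrightarrow> (\<forall>p\<le>x. excess f p x < 0)"
proof
  show "opener f x = None \<Longrightarrow> \<forall>p\<le>x. excess f p x < 0"
    by (metis not_less opener_nonneg option.distinct(1))
  show "\<forall>p\<le>x. excess f p x < 0 \<Longrightarrow> opener f x = None"
    by (metis not_less opener_Some opens_def option.exhaust)
qed

text \<open>This is the source of nesting. As \<open>p\<close> is the latest start that reaches
  \<open>y\<close>, the stretch \<open>x + 1..y\<close> has negative excess, so \<open>p..x\<close>
  must have nonnegative excess and \<open>x\<close> finds an opener no earlier than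
  \<open>p\<close>.\<close>

lemma opener_between:
  assumes "opener f y = Some p" "p \<le> x" "x \<le> y"
  obtains q where "p \<le> q" "q \<le> x" "opener f x = Some q"
proof -
  have y: "opens f y p" using assms(1) by (simp add: opener_Some)
  have "0 \<le> excess f p x"
  proof (cases "x = y")
    case True then show ?thesis using y by (simp add: opens_def)
  next
    case False
    then have "excess f (x + 1) y < 0" using y assms by (auto simp: opens_def)
    moreover have "excess f p y = excess f p x + excess f (x + 1) y"
      using assms by (intro excess_split) auto
    ultimately show ?thesis using y by (auto simp: opens_def)
  qed
  with assms(2) obtain q where "p \<le> q" "opener f x = Some q" by (rule opener_nonneg)
  then show ?thesis using that by (auto simp: opener_Some opens_def)
qed

section \<open>The two translations between weights and partitions\<close>

definition blocks_of :: "nat \<Rightarrow> (int \<Rightarrow> nat) \<Rightarrow> int set set" where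
  "blocks_of N f = range (\<lambda>x. label N ` {y. opener f y = opener f x})"

definition block :: "nat \<Rightarrow> int set set \<Rightarrow> int \<Rightarrow> int set" where
  "block N \<pi> x = \<Union>{V \<in> \<pi>. label N x \<in> V}"

text \<open>The first conjunct excludes the zero-block, since \<open>x - int N\<close> carries the
  negated label. Looking back less than half a turn suffices because a lift of a non-zero block fits
  into \<open>N\<close> consecutive positions.\<close>

definition initial :: "nat \<Rightarrow> int set set \<Rightarrow> int \<Rightarrow> bool" where
  "initial N \<pi> x \<longleftrightarrow> block N \<pi> x \<noteq> block N \<pi> (x - int N) \<and>
     (\<forall>y. x - int N < y \<and> y < x \<longrightarrow> block N \<pi> y \<noteq> block N \<pi> x)"

definition weight :: "nat \<Rightarrow> int set set \<Rightarrow> int \<Rightarrow> nat" where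
  "weight N \<pi> x = (if initial N \<pi> x then card (block N \<pi> x) else 0)"

section \<open>The walk of periodic weights with sum at most \<open>N\<close> over a period\<close>

locale weights = circle +
  fixes f :: "int \<Rightarrow> nat"
  assumes periodic: "f (x + int N) = f x"
    and total: "(\<Sum>i=0..<int N. f i) \<le> N"
begin

abbreviation opn :: "int \<Rightarrow> int option" where "opn \<equiv> opener f"

lemma periodic': "f (x - int N) = f x"
  using periodic[of "x - int N"] by simp

lemma excess_shift: "excess f (a + int N) (b + int N) = excess f a b"
  unfolding excess_def
  by (rule sum.reindex_bij_witness[of _ "\<lambda>i. i + int N" "\<lambda>i. i - int N"]) (auto simp: periodic')

lemma opens_shift: "opens f (x + int N) (p + int N) \<longleftrightarrow> opens f x p"
proof -
  have "(\<forall>q. p + int N < q \<and> q \<le> x + int N \<longrightarrow> excess f q (x + int N) < 0) \<longleftrightarrow>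
    (\<forall>q. p < q \<and> q \<le> x \<longrightarrow> excess f q x < 0)"
  proof (intro iffI allI impI)
    fix q assume "\<forall>q. p + int N < q \<and> q \<le> x + int N \<longrightarrow> excess f q (x + int N) < 0" "p < q \<and> q \<le> x"
    then show "excess f q x < 0" using excess_shift[of q x] by (auto dest: spec[of _ "q + int N"])
  next
    fix q assume "\<forall>q. p < q \<and> q \<le> x \<longrightarrow> excess f q x < 0" "p + int N < q \<and> q \<le> x + int N"
    then show "excess f q (x + int N) < 0" using excess_shift[of "q - int N" x]
      by (auto dest: spec[of _ "q - int N"])
  qed
  then show ?thesis by (auto simp: opens_def excess_shift)
qed

lemma opn_shift: "opn (x + int N) = map_option (\<lambda>p. p + int N) (opn x)"
proof (cases "opn x")
  case None
  have "\<not> opens f (x + int N) p" for p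
    using opens_shift[of x "p - int N"] None by (metis diff_add_cancel opener_Some option.distinct(1))
  then have "opn (x + int N) = None" by (metis opener_Some option.exhaust)
  then show ?thesis using None by simp
next
  case (Some p)
  then have "opn (x + int N) = Some (p + int N)" by (simp add: opener_Some opens_shift)
  then show ?thesis using Some by simp
qed

lemma opn_shift_mult_nat: "opn (x + int N * int i) = map_option (\<lambda>p. p + int N * int i) (opn x)"
proof (induction i)
  case (Suc i)
  have "opn (x + int N * int (Suc i)) = map_option (\<lambda>p. p + int N) (opn (x + int N * int i))"
    using opn_shift[of "x + int N * int i"] by (simp add: algebra_simps)
  then show ?case using Suc by (simp add: option.map_comp o_def algebra_simps)
qed (simp add: option.map_ident)

lemma opn_shift_mult: "opn (x + int N * i) = map_option (\<lambda>p. p + int N * i) (opn x)"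
proof (cases "0 \<le> i")
  case True
  then show ?thesis using opn_shift_mult_nat[of x "nat i"] by simp
next
  case False
  then have "opn x = map_option (\<lambda>p. p - int N * i) (opn (x + int N * i))"
    using opn_shift_mult_nat[of "x + int N * i" "nat (- i)"] by simp
  then show ?thesis by (simp add: option.map_comp o_def option.map_ident)
qed

lemma total_window: "excess f p (p + int N - 1) \<le> 0"
proof -
  have up: "excess f (int j) (int j + int N - 1) \<le> 0" for j
  proof (induction j)
    case 0
    have "{0..int N - 1} = {0..<int N}" by auto
    then show ?case using total by (subst excess_eq) (auto simp flip: of_nat_sum)
  next
    case (Suc j)
    \<comment> \<open>Sliding the window by one position drops \<open>f (int j)\<close> and gains
      the equal value \<open>f (int j + int N)\<close>.\<close>
    have "excess f (int j) (int j + int N) = excess f (int j) (int j) + excess f (int j + 1) (int j + int N)"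
      by (rule excess_split) auto
    moreover have "excess f (int j) (int j + int N) =
      excess f (int j) (int j + int N - 1) + excess f (int j + int N) (int j + int N)"
      using N_pos excess_split[of "int j" "int j + int N - 1" "int j + int N" f] by simp
    ultimately show ?case using Suc periodic[of "int j"] by (simp add: add_ac)
  qed
  have shift: "excess f (a + int N * int i) (b + int N * int i) = excess f a b" for a b i
  proof (induction i)
    case (Suc i)
    then show ?case using excess_shift[of "a + int N * int i" "b + int N * int i"]
      by (simp add: algebra_simps)
  qed simp
  \<comment> \<open>Shifting by \<open>\<bar>p\<bar>\<close> periods makes the left end nonnegative,
    where the induction applies.\<close>
  have "0 \<le> p + int N * int (nat \<bar>p\<bar>)"
  proof -
    have "1 * \<bar>p\<bar> \<le> int N * \<bar>p\<bar>" using N_pos by (intro mult_right_mono) auto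
    then show ?thesis by simp
  qed
  then obtain j where j: "p + int N * int (nat \<bar>p\<bar>) = int j" by (metis nonneg_int_cases)
  then have e: "p + int N - 1 + int N * int (nat \<bar>p\<bar>) = int j + int N - 1" by simp
  show ?thesis using up[of j] shift[of p "nat \<bar>p\<bar>" "p + int N - 1"] unfolding j e by simp
qed

text \<open>A match never spans a full period: the first \<open>N\<close> steps from
  \<open>p\<close> have total at most 0, and the remaining steps from \<open>p + int N\<close> have
  negative total by maximality of \<open>p\<close>.\<close>

lemma opn_bounds:
  assumes "opn x = Some p"
  shows "p \<le> x" "x < p + int N"
proof -
  have o: "opens f x p" using assms by (simp add: opener_Some)
  then show "p \<le> x" by (simp add: opens_def)
  show "x < p + int N"
  proof (rule ccontr)
    assume "\<not> x < p + int N"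
    then have "excess f (p + int N) x < 0" using o N_pos by (auto simp: opens_def)
    moreover have "excess f p x = excess f p (p + int N - 1) + excess f (p + int N) x"
      using excess_split[of p "p + int N - 1" x f] \<open>\<not> x < p + int N\<close> by simp
    ultimately show False using total_window[of p] o by (auto simp: opens_def)
  qed
qed

lemma opn_pos:
  assumes "opn x = Some p"
  shows "0 < f p"
proof (cases "x = p")
  case True
  then show ?thesis using assms by (simp add: opener_Some opens_def)
next
  case False
  then have "excess f (p + 1) x < 0" "0 \<le> excess f p x" "p < x"
    using assms by (auto simp: opener_Some opens_def)
  then show ?thesis using excess_split[of p p x f] by simp
qed

lemma opn_self: "0 < f p \<Longrightarrow> opn p = Some p"
  by (auto simp: opener_Some opens_def)

text \<open>The positions matched to \<open>p\<close> are the strict record lows of the walk started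
  at \<open>p\<close>, as long as it is nonnegative. The walk starts at height
  \<open>f p - 1\<close>, eventually drops to 0 or below and descends only by unit steps, so each
  height in \<open>0..<f p\<close> is a record exactly once.\<close>

lemma card_opn: "card {x. opn x = Some p} = f p"
proof -
  let ?O = "{x. opn x = Some p}" and ?h = "\<lambda>x. excess f p x"
  have rec: "x \<in> ?O \<longleftrightarrow> p \<le> x \<and> 0 \<le> ?h x \<and> (\<forall>y. p \<le> y \<and> y < x \<longrightarrow> ?h x < ?h y)" for x
  proof -
    have "excess f q x < 0 \<longleftrightarrow> ?h x < ?h (q - 1)" if "p < q" "q \<le> x" for q
      using excess_split[of p "q - 1" x f] that by simp
    then have "(\<forall>q. p < q \<and> q \<le> x \<longrightarrow> excess f q x < 0) \<longleftrightarrow> (\<forall>q. p < q \<and> q \<le> x \<longrightarrow> ?h x < ?h (q - 1))"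
      by blast
    also have "\<dots> \<longleftrightarrow> (\<forall>y. p \<le> y \<and> y < x \<longrightarrow> ?h x < ?h y)"
    proof safe
      fix y assume "\<forall>q. p < q \<and> q \<le> x \<longrightarrow> ?h x < ?h (q - 1)" "p \<le> y" "y < x"
      then show "?h x < ?h y" by (auto dest: spec[of _ "y + 1"])
    qed auto
    finally show ?thesis by (auto simp: opener_Some opens_def)
  qed
  have "bij_betw ?h ?O {0..<int (f p)}"
  proof (rule bij_betw_imageI)
    show "inj_on ?h ?O"
      by (rule linorder_inj_onI') (metis less_irrefl rec)
    show "?h ` ?O = {0..<int (f p)}"
    proof (intro subset_antisym subsetI)
      fix v assume "v \<in> ?h ` ?O"
      then obtain x where x: "x \<in> ?O" "v = ?h x" by auto
      then have "0 \<le> v" "?h x \<le> ?h p" using rec[of x] by (auto simp: le_less)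
      then show "v \<in> {0..<int (f p)}" using x by auto
    next
      fix v assume v: "v \<in> {0..<int (f p)}"
      have "?h (p + int (N - 1)) \<le> v" using total_window[of p] v N_pos by (simp add: of_nat_diff add_diff_eq)
      \<comment> \<open>The first time the walk is at height \<open>v\<close> or below; a full
        period is long enough for this to happen.\<close>
      define j where "j = (LEAST j. ?h (p + int j) \<le> v)"
      have j: "?h (p + int j) \<le> v" unfolding j_def by (rule LeastI) fact
      have less: "v < ?h (p + int i)" if "i < j" for i
        using that not_less_Least unfolding j_def by fastforce
      \<comment> \<open>The walk was above \<open>v\<close> one step earlier and cannot drop by more
        than 1, so it hits \<open>v\<close> exactly.\<close>
      have "v \<le> ?h (p + int j)"
      proof (cases j)
        case (Suc i)
        then have "v < ?h (p + int i)" using less by simp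
        moreover have "?h (p + int j) = ?h (p + int i) + (int (f (p + int j)) - 1)"
          using Suc excess_split[of p "p + int i" "p + int j" f] by (simp add: add_ac)
        ultimately show ?thesis by simp
      qed (use v in simp)
      with j have "?h (p + int j) = v" by simp
      moreover have "p + int j \<in> ?O"
      proof (subst rec, intro conjI allI impI)
        fix y assume y: "p \<le> y \<and> y < p + int j"
        then have "nat (y - p) < j" by auto
        from less[OF this] show "?h (p + int j) < ?h y" using y \<open>?h (p + int j) = v\<close> by simp
      qed (use v \<open>?h (p + int j) = v\<close> in auto)
      ultimately show "v \<in> ?h ` ?O" by auto
    qed
  qed
  then show ?thesis by (simp add: bij_betw_same_card)
qed

end

subsection \<open>From weights to non-crossing partitions\<close>

lemma block_eqI:
  assumes "partition_on A \<pi>" "V \<in> \<pi>" "label N x \<in> V"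
  shows "block N \<pi> x = V"
proof -
  have "{V \<in> \<pi>. label N x \<in> V} = {V}"
    using assms partition_onD2[OF assms(1)] by (auto simp: disjoint_def)
  then show ?thesis by (simp add: block_def)
qed

lemma negset_negset [simp]: "negset (negset V) = V"
  by (simp add: negset_def image_image)

context weights
begin

definition cls :: "int \<Rightarrow> int set" where
  "cls x \<equiv> lab ` {y. opn y = opn x}"

text \<open>Equal labels mean positions a multiple of \<open>2 * N\<close> apart, and openers
  commute with such shifts. Membership on the circle is thus equality of openers up to full
  turns.\<close>

lemma lab_in_cls_iff: "lab y \<in> cls x \<longleftrightarrow> (\<exists>i. opn y = map_option (\<lambda>p. p + 2 * int N * i) (opn x))"
proof
  assume "lab y \<in> cls x"
  then obtain z where z: "lab z = lab y" "opn z = opn x" by (auto simp: cls_def)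
  then obtain i where "y = z + 2 * int N * i" by (auto elim: lab_eqE)
  then show "\<exists>i. opn y = map_option (\<lambda>p. p + 2 * int N * i) (opn x)"
    using opn_shift_mult[of z "2 * i"] z by (auto simp: mult_ac)
next
  assume "\<exists>i. opn y = map_option (\<lambda>p. p + 2 * int N * i) (opn x)"
  then obtain i where i: "opn y = map_option (\<lambda>p. p + 2 * int N * i) (opn x)" by blast
  have "opn (y + 2 * int N * (- i)) = map_option (\<lambda>p. p + 2 * int N * (- i)) (opn y)"
    using opn_shift_mult[of y "- 2 * i"] by (simp add: mult_ac)
  then have "opn (y + 2 * int N * (- i)) = opn x"
    unfolding i by (simp add: option.map_comp o_def option.map_ident)
  then show "lab y \<in> cls x" unfolding cls_def by (metis (mono_tags) imageI lab_periodic mem_Collect_eq)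
qed

lemma cls_eq_iff: "cls y = cls x \<longleftrightarrow> lab y \<in> cls x"
proof
  have sub: "cls y \<subseteq> cls x" if "lab y \<in> cls x" for x y
  proof
    fix z assume "z \<in> cls y"
    then obtain w where w: "z = lab w" "opn w = opn y" by (auto simp: cls_def)
    then show "z \<in> cls x" using that unfolding w(1) lab_in_cls_iff by simp
  qed
  have sym: "lab x \<in> cls y" if yx: "lab y \<in> cls x" for x y
  proof -
    obtain i where i: "opn y = map_option (\<lambda>p. p + 2 * int N * i) (opn x)"
      using yx unfolding lab_in_cls_iff by blast
    have "opn x = map_option (\<lambda>p. p + 2 * int N * (- i)) (opn y)"
      unfolding i by (simp add: option.map_comp o_def option.map_ident)
    then show ?thesis unfolding lab_in_cls_iff by blast
  qed
  show "lab y \<in> cls x \<Longrightarrow> cls y = cls x"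
    by (rule equalityI[OF sub sub[OF sym]])
  show "cls y = cls x \<Longrightarrow> lab y \<in> cls x" by (auto simp: cls_def)
qed

lemma cls_eq_opn: "cls y = cls x \<longleftrightarrow> (\<exists>i. opn y = map_option (\<lambda>p. p + 2 * int N * i) (opn x))"
  by (simp only: cls_eq_iff lab_in_cls_iff)

lemma cls_eqI: "opn y = opn x \<Longrightarrow> cls y = cls x"
  by (simp add: cls_def)

lemma lab_in_cls: "lab x \<in> cls x"
  by (auto simp: cls_def)

lemma cls_subset: "cls x \<subseteq> range lab"
  by (auto simp: cls_def)

lemma opn_period: "opn (x + 2 * int N) = map_option (\<lambda>p. p + 2 * int N) (opn x)"
  "opn (x - 2 * int N) = map_option (\<lambda>p. p - 2 * int N) (opn x)"
  using opn_shift_mult[of x 2] opn_shift_mult[of x "- 2"] by (simp_all add: mult_ac)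

lemma cls_period: "cls (x - 2 * int N) = cls x"
proof -
  have "lab (x - 2 * int N) = lab x" using lab_periodic[of x "- 1"] by simp
  then have "lab (x - 2 * int N) \<in> cls x" by (simp add: lab_in_cls)
  then show ?thesis by (simp only: cls_eq_iff)
qed

lemma negset_cls: "negset (cls x) = cls (x + int N)"
proof -
  have "opn (y - int N) = opn x \<longleftrightarrow> opn y = opn (x + int N)" for y
    using opn_shift_mult[of "x + int N" "- 1"] opn_shift_mult[of y "- 1"] opn_shift[of "y - int N"]
    by (metis (no_types, lifting) add_diff_cancel_right' diff_add_cancel mult_minus1_right opn_shift uminus_add_conv_diff add.commute)
  then have "{y. opn y = opn (x + int N)} = (\<lambda>y. y + int N) ` {y. opn y = opn x}"
    by (force simp: image_iff)
  then show ?thesis by (simp add: cls_def negset_def image_image lab_shift)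
qed

text \<open>Negation moves the opener by \<open>N\<close>, while a class determines it up to
  multiples of \<open>2 * N\<close>; parity forbids equality unless there is no opener.\<close>

lemma negset_cls_eq_iff: "negset (cls x) = cls x \<longleftrightarrow> opn x = None"
proof
  assume "negset (cls x) = cls x"
  then obtain i where i: "opn (x + int N) = map_option (\<lambda>p. p + 2 * int N * i) (opn x)"
    unfolding negset_cls cls_eq_opn by blast
  show "opn x = None"
  proof (rule ccontr)
    assume "opn x \<noteq> None"
    then have "int N * 1 = int N * (2 * i)" using i opn_shift[of x] by auto
    then have "1 = 2 * i" using N_pos by (simp only: mult_cancel_left) simp
    then show False by presburger
  qed
next
  assume "opn x = None"
  then have "cls (x + int N) = cls x" by (simp add: cls_def opn_shift)
  then show "negset (cls x) = cls x" by (simp only: negset_cls)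
qed

text \<open>Apply nesting twice: \<open>b\<close> lies between \<open>a\<close> and
  \<open>c\<close>, so its opener is not before theirs, and \<open>c\<close> lies between
  \<open>b\<close> and \<open>d\<close>, which gives the reverse inequality.\<close>

lemma opn_noncrossing:
  assumes "a < b" "b < c" "c < d" "opn a = opn c" "opn b = opn d"
  shows "opn a = opn b"
proof -
  have between: "\<exists>r. p \<le> r \<and> opn v = Some r"
    if "u < v" "v < w" "opn u = Some p" "opn w = Some p" for u v w p
    using that opn_bounds(1)[of u p] opener_between[of f w p v] by (metis less_imp_le order_trans)
  show ?thesis
  proof (cases "opn d")
    case None
    show ?thesis
    proof (cases "opn c")
      case (Some p)
      then show ?thesis using between[of a b c p] assms None by simp
    qed (use None assms in simp)
  next
    case (Some q)
    then obtain p where p: "q \<le> p" "opn c = Some p" using between[of b c d q] assms by auto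
    then show ?thesis using between[of a b c p] assms Some by auto
  qed
qed

text \<open>An opener trails its position by less than \<open>N\<close>. For positions less than
  \<open>2 * N\<close> apart, the offset of the openers lies strictly between \<open>- N\<close> and
  \<open>3 * N\<close>, which leaves no turn or one turn.\<close>

lemma cls_window:
  assumes "cls x = cls y" "x < y" "y < x + 2 * int N"
  shows "opn x = opn y \<or> opn x = opn (y - 2 * int N)"
proof (cases "opn x")
  case None
  then show ?thesis using assms(1) unfolding cls_eq_opn by auto
next
  case (Some p)
  obtain i where i: "opn y = map_option (\<lambda>p. p + 2 * int N * i) (opn x)"
    using assms(1)[symmetric] unfolding cls_eq_opn by blast
  then have y: "opn y = Some (p + 2 * int N * i)" using Some by simp
  have "- int N < 2 * int N * i" "2 * int N * i < 3 * int N"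
    using opn_bounds[OF Some] opn_bounds[OF y] assms by linarith+
  then have "int N * (- 1) < int N * (2 * i)" "int N * (2 * i) < int N * 3" by linarith+
  moreover have "0 < int N" using N_pos by simp
  ultimately have "- 1 < 2 * i" "2 * i < 3" by (metis mult_less_cancel_left_pos)+
  then have "i = 0 \<or> i = 1" by auto
  then show ?thesis using Some y by (auto simp: opn_period)
qed

lemma cls_noncrossing_aux:
  assumes "a < b" "b < c" "c < d" "d < a + 2 * int N" and ac: "opn a = opn c" and bd: "cls b = cls d"
  shows "cls a = cls b"
proof -
  have "b < d" "d < b + 2 * int N" "d - 2 * int N < a" using assms(1-4) by linarith+
  from cls_window[OF bd this(1,2)] have "opn a = opn b"
  proof
    assume "opn b = opn d"
    from opn_noncrossing[OF assms(1-3) ac this] show ?thesis .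
  next
    \<comment> \<open>Replacing \<open>d\<close> by its translate rotates the crossing to
      \<open>d - 2 * int N < a < b < c\<close>.\<close>
    assume "opn b = opn (d - 2 * int N)"
    from opn_noncrossing[OF \<open>d - 2 * int N < a\<close> assms(1,2) this[symmetric] ac] this ac
    show ?thesis by simp
  qed
  then show ?thesis by (rule cls_eqI)
qed

lemma cls_noncrossing:
  assumes "a < b" "b < c" "c < d" "d < a + 2 * int N" and ac: "cls a = cls c" and bd: "cls b = cls d"
  shows "cls a = cls b"
proof -
  have *: "a < c" "c < a + 2 * int N" "c - 2 * int N < d - 2 * int N" "d - 2 * int N < a"
    "b < (c - 2 * int N) + 2 * int N" using assms(1-4) by linarith+
  from cls_window[OF ac *(1,2)] show ?thesis
  proof
    assume "opn a = opn c"
    from cls_noncrossing_aux[OF assms(1-4) this bd] show ?thesis .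
  next
    assume opn: "opn a = opn (c - 2 * int N)"
    \<comment> \<open>The rotated points \<open>c - 2 * int N < d - 2 * int N < a < b\<close> fit
      into one turn again, and now the first and third have equal openers.\<close>
    have "cls (d - 2 * int N) = cls b" using bd by (simp only: cls_period)
    from cls_noncrossing_aux[OF *(3,4) assms(1) *(5) opn[symmetric] this]
    show ?thesis using ac bd by (simp only: cls_period)
  qed
qed

lemma blocks_of_eq: "blocks_of N f = range cls"
  by (simp add: blocks_of_def cls_def[abs_def])

lemma partition_blocks_of: "partition_on (pmset N) (blocks_of N f)"
proof (rule partition_onI)
  have "\<Union>(range cls) = range lab" using lab_in_cls cls_subset by blast
  then show "\<Union>(blocks_of N f) = pmset N" by (simp only: blocks_of_eq range_lab)
  show "{} \<notin> blocks_of N f" using lab_in_cls by (force simp: blocks_of_eq)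
  show "disjnt V W" if VW: "V \<in> blocks_of N f" "W \<in> blocks_of N f" "V \<noteq> W" for V W
  proof -
    obtain x y where xy: "V = cls x" "W = cls y" using VW by (auto simp: blocks_of_eq)
    have False if z: "z \<in> V" "z \<in> W" for z
    proof -
      obtain w where "z = lab w" using z cls_subset by (auto simp: xy)
      then have "cls w = V" "cls w = W" using z by (simp_all only: xy cls_eq_iff)
      then show False using \<open>V \<noteq> W\<close> by simp
    qed
    then show ?thesis by (auto simp: disjnt_def)
  qed
qed

lemma block_blocks_of: "block N (blocks_of N f) x = cls x"
  by (rule block_eqI[OF partition_blocks_of]) (auto simp: blocks_of_eq lab_in_cls)

lemma cls_block: "V \<in> blocks_of N f \<Longrightarrow> lab x \<in> V \<Longrightarrow> cls x = V"
  using block_eqI[OF partition_blocks_of] block_blocks_of by metis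

lemma noncrossing_blocks_of: "noncrossingB N (blocks_of N f)"
  unfolding noncrossingB_def
proof (intro ballI impI notI)
  fix V W assume V: "V \<in> blocks_of N f" and W: "W \<in> blocks_of N f" and "V \<noteq> W"
  assume "\<exists>a b c d. a \<in> V \<and> c \<in> V \<and> b \<in> W \<and> d \<in> W \<and>
              posB N a < posB N b \<and> posB N b < posB N c \<and> posB N c < posB N d"
  then obtain a b c d where *: "a \<in> V" "c \<in> V" "b \<in> W" "d \<in> W"
     "posB N a < posB N b" "posB N b < posB N c" "posB N c < posB N d" by blast
  \<comment> \<open>Representatives in \<open>0..<2 * int N\<close> are ordered as their
    \<open>posB\<close> values, so a crossing lifts to a crossing of positions.\<close>
  have "\<exists>x. 0 \<le> x \<and> x < 2 * int N \<and> lab x = z" if "z \<in> V \<union> W" for z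
    using that partition_onD1[OF partition_blocks_of] V W lab_surj by (metis UnE UnionI)
  then obtain a' b' c' d' where **: "0 \<le> a'" "a' < 2 * int N" "lab a' = a"
    "0 \<le> b'" "b' < 2 * int N" "lab b' = b" "0 \<le> c'" "c' < 2 * int N" "lab c' = c"
    "0 \<le> d'" "d' < 2 * int N" "lab d' = d" using * by (metis UnI1 UnI2)
  have "a' < b'" "b' < c'" "c' < d'"
    using *(5-7) ** posB_lab[of a'] posB_lab[of b'] posB_lab[of c'] posB_lab[of d'] by simp_all
  moreover have "cls a' = V" "cls c' = V" "cls b' = W" "cls d' = W"
    using V W * ** cls_block by metis+
  ultimately show False using cls_noncrossing[of a' b' c' d'] ** \<open>V \<noteq> W\<close> by simp
qed

lemma blocks_of_in_NC_B: "blocks_of N f \<in> NC_B N"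
proof -
  have "negset V \<in> blocks_of N f" if "V \<in> blocks_of N f" for V
    using that unfolding blocks_of_eq by (auto simp only: negset_cls)
  moreover have "card {V \<in> blocks_of N f. negset V = V} \<le> 1"
  proof -
    have "{V \<in> blocks_of N f. negset V = V} \<subseteq> {lab ` {y. opn y = None}}"
    proof
      fix V assume "V \<in> {V \<in> blocks_of N f. negset V = V}"
      then obtain x where "V = cls x" "negset (cls x) = cls x" unfolding blocks_of_eq by blast
      moreover from this have "opn x = None" by (simp add: negset_cls_eq_iff)
      ultimately show "V \<in> {lab ` {y. opn y = None}}" by (simp add: cls_def)
    qed
    then have "card {V \<in> blocks_of N f. negset V = V} \<le> card {lab ` {y. opn y = None}}"
      by (intro card_mono) auto
    then show ?thesis by simp
  qed
  ultimately show ?thesis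
    using partition_blocks_of noncrossing_blocks_of by (simp add: NC_B_def)
qed

text \<open>The opener of \<open>x\<close> lies in the class of \<open>x\<close> less than
  \<open>N\<close> positions back, so an initial \<open>x\<close> is its own opener. Conversely, if
  \<open>f x > 0\<close>, an earlier \<open>y\<close> of the same class in the window would have
  opener \<open>x\<close> or \<open>x - 2 * int N\<close>, and both are out of reach.\<close>

lemma initial_blocks_of: "initial N (blocks_of N f) x \<longleftrightarrow> 0 < f x"
proof
  assume op: "initial N (blocks_of N f) x"
  have "opn x \<noteq> None"
  proof
    assume "opn x = None"
    then have "opn (x - int N) = opn x" using opn_shift[of "x - int N"] by simp
    then have "cls (x - int N) = cls x" by (rule cls_eqI)
    then show False using op by (simp add: initial_def block_blocks_of)
  qed
  then obtain p where p: "opn x = Some p" by auto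
  then have "opn p = Some p" using opn_pos opn_self by blast
  then have "cls p = cls x" using p by (intro cls_eqI) simp
  then have "\<not> (x - int N < p \<and> p < x)" using op by (auto simp: initial_def block_blocks_of)
  then have "p = x" using opn_bounds[OF p] by simp
  then show "0 < f x" using opn_pos p by blast
next
  assume "0 < f x"
  then have x: "opn x = Some x" by (rule opn_self)
  have "opn (x - int N) \<noteq> None"
    using opn_shift[of "x - int N"] x by (metis diff_add_cancel option.map_disc_iff option.distinct(1))
  then have "cls x \<noteq> cls (x - int N)"
    using negset_cls[of "x - int N"] negset_cls_eq_iff[of "x - int N"] by (metis diff_add_cancel)
  moreover have "cls y \<noteq> cls x" if y: "x - int N < y" "y < x" for y
  proof
    assume "cls y = cls x"
    then have "opn y = opn x \<or> opn y = opn (x - 2 * int N)"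
      by (rule cls_window) (use y N_pos in auto)
    then show False
    proof
      assume "opn y = opn x"
      then show False using opn_bounds[of y x] x y by simp
    next
      assume "opn y = opn (x - 2 * int N)"
      then have "opn y = Some (x - 2 * int N)" using x by (simp add: opn_period)
      from opn_bounds[OF this] show False using y by simp
    qed
  qed
  ultimately show "initial N (blocks_of N f) x" by (simp add: initial_def block_blocks_of)
qed

lemma weight_blocks_of: "weight N (blocks_of N f) = f"
proof
  fix x
  have "card (cls x) = f x" if "0 < f x"
  proof -
    have x: "opn x = Some x" using that by (rule opn_self)
    \<comment> \<open>Positions with a common opener lie within \<open>N\<close> of each other, so
      passing to labels keeps the count of \<open>card_opn\<close>.\<close>
    have "inj_on lab {y. opn y = Some x}"
    proof (rule inj_onI)
      fix y z assume "y \<in> {y. opn y = Some x}" "z \<in> {y. opn y = Some x}" and lab: "lab y = lab z"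
      then have yz: "opn y = Some x" "opn z = Some x" by simp_all
      have "\<bar>y - z\<bar> < 2 * int N"
        using opn_bounds[OF yz(1)] opn_bounds[OF yz(2)] by linarith
      then show "y = z" using lab by (rule lab_eq_window[rotated])
    qed
    then have "card (lab ` {y. opn y = Some x}) = f x" by (simp only: card_image card_opn)
    then show ?thesis by (simp add: cls_def x)
  qed
  then show "weight N (blocks_of N f) x = f x"
    by (simp add: weight_def initial_blocks_of block_blocks_of)
qed

end

subsection \<open>From non-crossing partitions to weights\<close>

locale nc_partition = circle +
  fixes \<pi> :: "int set set"
  assumes nc: "\<pi> \<in> NC_B N"
begin

abbreviation bl :: "int \<Rightarrow> int set" where "bl \<equiv> block N \<pi>"
abbreviation zero :: "int \<Rightarrow> bool" where "zero x \<equiv> negset (bl x) = bl x"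

lemma part: "partition_on (pmset N) \<pi>"
  using nc by (simp add: NC_B_def)

lemma bl_eqI: "V \<in> \<pi> \<Longrightarrow> lab x \<in> V \<Longrightarrow> bl x = V"
  by (rule block_eqI[OF part])

lemma ex_block:
  obtains V where "V \<in> \<pi>" "lab x \<in> V"
  using partition_onD1[OF part] lab_range[of x] by blast

lemma bl_in: "bl x \<in> \<pi>" and lab_in_bl: "lab x \<in> bl x"
  using bl_eqI by (metis ex_block)+

lemma bl_eq_iff: "bl x = bl y \<longleftrightarrow> lab x \<in> bl y"
  using bl_eqI bl_in lab_in_bl by metis

lemma bl_cong: "lab x = lab y \<Longrightarrow> bl x = bl y"
  by (simp add: block_def)

lemma bl_period: "bl (x + 2 * int N) = bl x" "bl (x - 2 * int N) = bl x"
  using bl_cong[OF lab_periodic, of x 1] bl_cong[OF lab_periodic, of x "- 1"] by simp_all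

lemma bl_shift: "bl (x + int N) = negset (bl x)"
  using nc bl_in[of x] lab_in_bl[of x]
  by (intro bl_eqI) (auto simp: NC_B_def negset_def lab_shift)

lemma bl_unshift: "bl (x - int N) = negset (bl x)"
  using bl_shift[of "x - int N"] by simp

lemma bl_subset: "bl x \<subseteq> pmset N"
  using partition_onD1[OF part] bl_in by blast

lemma range_bl: "range bl = \<pi>"
proof (intro subset_antisym subsetI)
  fix V assume V: "V \<in> \<pi>"
  then obtain z where "z \<in> V" using partition_onD3[OF part] by fastforce
  moreover from this have "z \<in> range lab" using V partition_onD1[OF part] range_lab by auto
  then obtain x where "lab x = z" by blast
  ultimately have "bl x = V" using V bl_eqI by blast
  then show "V \<in> range bl" by blast
qed (use bl_in in auto)

lemma zero_unique: "zero x \<Longrightarrow> zero y \<Longrightarrow> bl x = bl y"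
proof -
  assume "zero x" "zero y"
  then have "{bl x, bl y} \<subseteq> {V \<in> \<pi>. negset V = V}" using bl_in by auto
  moreover have "finite \<pi>" using finite_elements[OF finite_pmset part] .
  then have "finite {V \<in> \<pi>. negset V = V}" by simp
  ultimately have "card {bl x, bl y} \<le> card {V \<in> \<pi>. negset V = V}" by (intro card_mono)
  then have "card {bl x, bl y} \<le> 1" using nc by (simp add: NC_B_def)
  then show ?thesis by (cases "bl x = bl y") auto
qed

lemma noncrossing_window:
  assumes "0 \<le> a" "a < b" "b < c" "c < d" "d < 2 * int N" "bl a = bl c" "bl b = bl d"
  shows "bl a = bl b"
proof (rule ccontr)
  assume "bl a \<noteq> bl b"
  moreover have "posB N (lab a) < posB N (lab b)" "posB N (lab b) < posB N (lab c)"
    "posB N (lab c) < posB N (lab d)"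
    using assms by (simp_all add: posB_lab)
  moreover have "lab a \<in> bl a" "lab b \<in> bl b" "lab c \<in> bl a" "lab d \<in> bl b"
    using lab_in_bl assms(6,7) by metis+
  moreover have "noncrossingB N \<pi>" using nc by (simp add: NC_B_def)
  ultimately show False unfolding noncrossingB_def using bl_in[of a] bl_in[of b] by metis
qed

text \<open>Crossing is invariant under cyclic rotation of the four points, so the cut of the circle
  at position 0 does not matter.\<close>

lemma bl_noncrossing:
  assumes "a < b" "b < c" "c < d" "d < a + 2 * int N" and ac: "bl a = bl c" and bd: "bl b = bl d"
  shows "bl a = bl b"
proof -
  \<comment> \<open>The translation by whole turns that brings \<open>a\<close> into
    \<open>0..<2 * int N\<close>.\<close>
  define s where "s = 2 * int N * (a div (2 * int N))"
  have s: "bl (x - s) = bl x" for x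
    using lab_periodic[of x "- (a div (2 * int N))"] by (intro bl_cong) (simp add: s_def)
  have a: "a - s = a mod (2 * int N)" by (simp add: s_def minus_mult_div_eq_mod)
  have "0 \<le> a - s" "a - s < 2 * int N" unfolding a by (rule mod_bounds)+
  \<comment> \<open>The cases tell which of the later points pass the cut; those are moved back one
    turn and come first in the rotated quadruple.\<close>
  then consider "d - s < 2 * int N" | "c - s < 2 * int N" "2 * int N \<le> d - s"
    | "b - s < 2 * int N" "2 * int N \<le> c - s" | "2 * int N \<le> b - s"
    by linarith
  then show ?thesis
  proof cases
    case 1
    then show ?thesis
      using noncrossing_window[of "a - s" "b - s" "c - s" "d - s"] assms \<open>0 \<le> a - s\<close> by (simp add: s)
  next
    case 2
    then show ?thesis
      using noncrossing_window[of "d - s - 2 * int N" "a - s" "b - s" "c - s"] assms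
      by (simp add: s bl_period)
  next
    case 3
    then show ?thesis
      using noncrossing_window[of "c - s - 2 * int N" "d - s - 2 * int N" "a - s" "b - s"]
        assms by (simp add: s bl_period)
  next
    case 4
    then show ?thesis
      using noncrossing_window[of "b - s - 2 * int N" "c - s - 2 * int N" "d - s - 2 * int N" "a - s"]
        assms \<open>a - s < 2 * int N\<close> by (simp add: s bl_period)
  qed
qed

section \<open>Lifted blocks and the recovery of a partition from its weights\<close>

abbreviation init :: "int \<Rightarrow> bool" where "init \<equiv> initial N \<pi>"
abbreviation wt :: "int \<Rightarrow> nat" where "wt \<equiv> weight N \<pi>"

lemma init_nonzero: "init p \<Longrightarrow> \<not> zero p"
  by (metis initial_def bl_unshift)

lemma init_window:
  assumes "init p" "bl y = bl p" "p - int N < y"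
  shows "p \<le> y"
  using assms unfolding initial_def by force

text \<open>The least position of the block in the half turn that ends at \<open>x\<close> is
  initial: any position of the same block shortly before it would produce a crossing with the
  negated block.\<close>

lemma initial_exists:
  assumes "\<not> zero x"
  obtains p where "init p" "p \<le> x" "x < p + int N" "bl p = bl x"
proof -
  define A where "A = {x - int N<..x} \<inter> {y. bl y = bl x}"
  define p where "p = Min A"
  have A: "finite A" "x \<in> A" using N_pos by (auto simp: A_def)
  then have "p \<in> A" unfolding p_def by (intro Min_in) auto
  then have p: "x - int N < p" "p \<le> x" "bl p = bl x" by (auto simp: A_def)
  have min: "p \<le> y" if "y \<in> A" for y using A that by (simp add: p_def)
  have "init p"
    unfolding initial_def
  proof (intro conjI allI impI notI)
    show False if "bl p = bl (p - int N)" using that assms p by (simp add: bl_unshift)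
    fix y assume y: "p - int N < y \<and> y < p" "bl y = bl p"
    have "y \<notin> A" using min[of y] y by auto
    then have "y \<le> x - int N" using y p by (auto simp: A_def)
    moreover have "y \<noteq> x - int N" using y p assms bl_unshift[of x] by auto
    ultimately have "y < x - int N" by simp
    \<comment> \<open>In \<open>p - int N < y < x - int N < p\<close> the outer pattern alternates
      between the negated block and the block itself.\<close>
    have "bl (p - int N) = bl y"
      by (rule bl_noncrossing[of _ _ "x - int N" p])
         (use y p \<open>y < x - int N\<close> N_pos in \<open>auto simp: bl_unshift\<close>)
    then show False using y p assms by (simp add: bl_unshift)
  qed
  with p show ?thesis by (intro that[of p]) auto
qed

definition lifted_block :: "int \<Rightarrow> int set" where
  "lifted_block p = {p..<p + int N} \<inter> {y. bl y = bl p}"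

lemma finite_lifted_block: "finite (lifted_block p)" by (simp add: lifted_block_def)

text \<open>Each element has a representative in the full turn from \<open>p\<close>. It cannot be
  \<open>p + int N\<close>, whose label lies in the negated block, nor any later position, whose
  translate by \<open>- 2 * int N\<close> would lie shortly before \<open>p\<close>.\<close>

lemma lab_lifted_block:
  assumes "init p"
  shows "lab ` lifted_block p = bl p"
proof (intro subset_antisym subsetI)
  fix z assume "z \<in> lab ` lifted_block p"
  then obtain y where "z = lab y" "bl y = bl p" by (auto simp: lifted_block_def)
  then show "z \<in> bl p" using lab_in_bl by metis
next
  fix z assume z: "z \<in> bl p"
  then obtain x where x: "lab x = z" using bl_subset lab_surj by blast
  define y where "y = p + (x - p) mod (2 * int N)"
  have "lab y = z"
    unfolding x[symmetric] lab_eq_iff y_def by (simp add: mod_add_right_eq)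
  have y: "p \<le> y" "y < p + 2 * int N" using mod_bounds[of "x - p"] by (auto simp: y_def)
  have bly: "bl y = bl p" unfolding bl_eq_iff \<open>lab y = z\<close> by (rule z)
  have "y < p + int N"
  proof (rule ccontr)
    assume "\<not> y < p + int N"
    moreover have "y \<noteq> p + int N" using bly init_nonzero[OF assms] bl_shift[of p] by metis
    ultimately have "p - int N < y - 2 * int N" by simp
    then have "p \<le> y - 2 * int N" using bly bl_period(2)[of y] by (intro init_window[OF assms]) simp_all
    then show False using y by simp
  qed
  then show "z \<in> lab ` lifted_block p" using y bly \<open>lab y = z\<close> by (auto simp: lifted_block_def)
qed

lemma card_lifted_block: "init p \<Longrightarrow> card (lifted_block p) = card (bl p)"
proof -
  have "inj_on lab (lifted_block p)" by (rule inj_onI, rule lab_eq_window) (auto simp: lifted_block_def)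
  then show "init p \<Longrightarrow> card (lifted_block p) = card (bl p)" using lab_lifted_block card_image by metis
qed

lemma lifted_block_disjoint: "init p \<Longrightarrow> init q \<Longrightarrow> p \<noteq> q \<Longrightarrow> lifted_block p \<inter> lifted_block q = {}"
proof (rule ccontr)
  assume *: "init p" "init q" "p \<noteq> q" "lifted_block p \<inter> lifted_block q \<noteq> {}"
  then obtain y where "p \<le> y" "y < p + int N" "q \<le> y" "y < q + int N" "bl p = bl q"
    by (auto simp: lifted_block_def)
  then show False using * init_window[of p q] init_window[of q p] by auto
qed

text \<open>Lifted blocks with different starts are disjoint, so sums of weights count covered
  positions and bounds on the excess become inclusions of sets.\<close>

lemma sum_wt: "(\<Sum>i=a..x. wt i) = card (\<Union>q\<in>{a..x} \<inter> Collect init. lifted_block q)"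
proof -
  have "card (\<Union>q\<in>{a..x} \<inter> Collect init. lifted_block q) = (\<Sum>q\<in>{a..x} \<inter> Collect init. card (lifted_block q))"
    by (rule card_UN_disjoint) (use lifted_block_disjoint finite_lifted_block in auto)
  also have "\<dots> = (\<Sum>q\<in>{a..x} \<inter> Collect init. card (bl q))"
    by (rule sum.cong) (auto simp: card_lifted_block)
  also have "\<dots> = (\<Sum>i=a..x. wt i)"
    unfolding weight_def by (subst sum.inter_restrict) auto
  finally show ?thesis by simp
qed

text \<open>The block of \<open>x\<close> has an element before \<open>a\<close>, or is the
  zero-block. A lifted block that starts in \<open>a..x\<close> and reaches past \<open>x\<close>
  would cross it, so all of them stay inside \<open>a..<x\<close>, which is one position
  short.\<close>

lemma excess_neg:
  assumes "a \<le> x" and new: "\<And>q. a \<le> q \<Longrightarrow> q \<le> x \<Longrightarrow> init q \<Longrightarrow> bl q \<noteq> bl x"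
    and earlier: "zero x \<or> (\<exists>p. p < a \<and> x < p + int N \<and> bl p = bl x)"
  shows "excess wt a x < 0"
proof -
  have "lifted_block q \<subseteq> {a..<x}" if q: "a \<le> q" "q \<le> x" "init q" for q
  proof
    fix y assume "y \<in> lifted_block q"
    then have y: "q \<le> y" "y < q + int N" "bl y = bl q" by (auto simp: lifted_block_def)
    have ne: "bl q \<noteq> bl x" using new q by blast
    then have "q < x" "y \<noteq> x" using q y by (auto simp: le_less)
    have "y < x"
    proof (rule ccontr)
      assume "\<not> y < x"
      then have "x < y" using \<open>y \<noteq> x\<close> by simp
      obtain p where p: "p < q" "y < p + 2 * int N" "bl p = bl x"
        using earlier
      proof
        assume "zero x"
        \<comment> \<open>The zero-block also contains the label at \<open>x - int N\<close>, which
          supplies the earlier element.\<close>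
        then show ?thesis using that[of "x - int N"] y \<open>x < y\<close> \<open>q < x\<close>
          by (simp add: bl_unshift)
      next
        assume "\<exists>p. p < a \<and> x < p + int N \<and> bl p = bl x"
        then obtain p where "p < a" "x < p + int N" "bl p = bl x" by blast
        then show ?thesis using that[of p] y q by simp
      qed
      then have "bl p = bl q"
        using y \<open>q < x\<close> \<open>x < y\<close> by (intro bl_noncrossing[of p q x y]) auto
      then show False using ne p by simp
    qed
    then show "y \<in> {a..<x}" using y q by simp
  qed
  then have "(\<Union>q\<in>{a..x} \<inter> Collect init. lifted_block q) \<subseteq> {a..<x}" by (intro UN_least) simp
  from card_mono[OF _ this] have "(\<Sum>i=a..x. wt i) \<le> card {a..<x}" by (simp add: sum_wt)
  then show ?thesis using assms(1) by (simp add: excess_eq flip: of_nat_sum)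
qed

text \<open>The blocks that start in \<open>p..x\<close> cover this interval. A position strictly
  between \<open>p\<close> and \<open>x\<close> in another block can neither belong to the
  zero-block nor have its start before \<open>p\<close>, since both would cross the block of
  \<open>p\<close> and \<open>x\<close>.\<close>

lemma excess_nonneg:
  assumes p: "init p" "p \<le> x" "x < p + int N" "bl p = bl x"
  shows "0 \<le> excess wt p x"
proof -
  have "{p..x} \<subseteq> (\<Union>q\<in>{p..x} \<inter> Collect init. lifted_block q)"
  proof
    fix y assume "y \<in> {p..x}"
    then have y: "p \<le> y" "y \<le> x" by auto
    show "y \<in> (\<Union>q\<in>{p..x} \<inter> Collect init. lifted_block q)"
    proof (cases "bl y = bl p")
      case True
      then have "y \<in> lifted_block p" using y p by (auto simp: lifted_block_def)
      then show ?thesis using p by auto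
    next
      case False
      then have y': "p < y" "y < x" using y p by (auto simp: le_less)
      have "\<not> zero y"
      proof
        assume "zero y"
        then have "bl p = bl y"
          using y' p by (intro bl_noncrossing[of p y x "y + int N"]) (auto simp: bl_shift)
        then show False using False by simp
      qed
      then obtain q where q: "init q" "q \<le> y" "y < q + int N" "bl q = bl y"
        by (rule initial_exists)
      have "p \<le> q"
      proof (rule ccontr)
        assume "\<not> p \<le> q"
        then have "bl q = bl p"
          using y' p q by (intro bl_noncrossing[of q p y x]) auto
        then show False using False q by simp
      qed
      moreover have "y \<in> lifted_block q" using q by (auto simp: lifted_block_def)
      ultimately show ?thesis using q y by auto
    qed
  qed
  from card_mono[OF _ this] have "card {p..x} \<le> (\<Sum>i=p..x. wt i)" by (simp add: sum_wt finite_lifted_block)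
  then show ?thesis using p by (simp add: excess_eq flip: of_nat_sum)
qed

lemma opener_zero:
  assumes "zero x"
  shows "opener wt x = None"
proof -
  have "excess wt a x < 0" if "a \<le> x" for a
    using that assms init_nonzero by (intro excess_neg) (auto, metis)
  then show ?thesis by (simp add: opener_None)
qed

lemma opener_nonzero:
  assumes p: "init p" "p \<le> x" "x < p + int N" "bl p = bl x"
  shows "opener wt x = Some p"
proof -
  have "excess wt a x < 0" if "p < a" "a \<le> x" for a
  proof (rule excess_neg[OF that(2)])
    show "bl q \<noteq> bl x" if "a \<le> q" "q \<le> x" "init q" for q
      using init_window[of q p] that \<open>p < a\<close> p by auto
  qed (use that p in blast)
  then show ?thesis using excess_nonneg[OF p] p by (simp add: opener_Some opens_def)
qed

text \<open>Unmatched positions are exactly the lifts of the zero-block, and the positions matched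
  to a start \<open>p\<close> form its lifted block. Hence decoding the weights returns
  \<open>\<pi>\<close>.\<close>

lemma opener_class: "lab ` {y. opener wt y = opener wt x} = bl x"
proof (cases "zero x")
  case True
  have None_iff: "opener wt y = None \<longleftrightarrow> zero y" for y
  proof
    show "zero y" if y: "opener wt y = None"
    proof (rule ccontr)
      assume "\<not> zero y"
      then obtain p where "init p" "p \<le> y" "y < p + int N" "bl p = bl y" by (rule initial_exists)
      then show False using opener_nonzero[of p y] y by simp
    qed
  qed (rule opener_zero)
  have "opener wt y = opener wt x \<longleftrightarrow> zero y" for y
    using opener_zero[OF True] None_iff[of y] by simp
  moreover have "zero y \<longleftrightarrow> bl y = bl x" for y
    using True zero_unique[OF _ True, of y] by metis
  ultimately have "{y. opener wt y = opener wt x} = lab -` bl x"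
    by (simp only: bl_eq_iff vimage_def)
  also have "lab ` \<dots> = bl x"
    using bl_subset[of x] by (simp add: image_vimage_eq range_lab Int_absorb2)
  finally show ?thesis .
next
  case False
  then obtain p where p: "init p" "p \<le> x" "x < p + int N" "bl p = bl x" by (rule initial_exists)
  have "opener wt y = Some p \<longleftrightarrow> y \<in> lifted_block p" for y
  proof
    assume y: "opener wt y = Some p"
    then have "\<not> zero y" using opener_zero[of y] by auto
    then obtain q where q: "init q" "q \<le> y" "y < q + int N" "bl q = bl y" by (rule initial_exists)
    then have "q = p" using opener_nonzero[OF q] y by simp
    then show "y \<in> lifted_block p" using q by (simp add: lifted_block_def)
  next
    assume "y \<in> lifted_block p"
    then have "p \<le> y" "y < p + int N" "bl p = bl y" by (simp_all add: lifted_block_def)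
    then show "opener wt y = Some p" by (rule opener_nonzero[OF p(1)])
  qed
  then have "{y. opener wt y = opener wt x} = lifted_block p" by (simp add: opener_nonzero[OF p])
  then show ?thesis using lab_lifted_block[OF p(1)] p(4) by simp
qed

lemma blocks_of_weight: "blocks_of N wt = \<pi>"
  by (simp add: blocks_of_def opener_class range_bl)

lemma init_shift: "init (x + int N) \<longleftrightarrow> init x"
proof -
  have neg: "negset V = negset W \<longleftrightarrow> V = W" for V W by (metis negset_negset)
  have "(\<forall>y. x < y \<and> y < x + int N \<longrightarrow> bl y \<noteq> negset (bl x)) \<longleftrightarrow>
    (\<forall>y. x - int N < y \<and> y < x \<longrightarrow> bl y \<noteq> bl x)" (is "?L \<longleftrightarrow> ?R")
  proof (intro iffI allI impI)
    fix y assume ?L "x - int N < y \<and> y < x"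
    then have "bl (y + int N) \<noteq> negset (bl x)" by simp
    then show "bl y \<noteq> bl x" by (auto simp: bl_shift)
  next
    fix y assume ?R "x < y \<and> y < x + int N"
    then have "bl (y - int N) \<noteq> bl x" by simp
    then show "bl y \<noteq> negset (bl x)" by (auto simp: bl_unshift)
  qed
  then show ?thesis by (auto simp: initial_def bl_shift bl_unshift neg)
qed

lemma card_negset: "card (negset V) = card V"
  by (simp add: negset_def card_image)

lemma wt_periodic: "wt (x + int N) = wt x"
  by (simp add: weight_def init_shift bl_shift card_negset)

text \<open>Two starts \<open>p < q\<close> of one block within a turn are more than
  \<open>N\<close> apart, because exactly \<open>N\<close> means negation. Then
  \<open>q - 2 * int N\<close> falls into the forbidden window before \<open>p\<close>.\<close>

lemma bij_betw_initial: "bij_betw bl {q \<in> {0..<2 * int N}. init q} {V \<in> \<pi>. negset V \<noteq> V}"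
proof (rule bij_betw_imageI)
  have less: False if pq: "init p" "init q" "0 \<le> p" "p < q" "q < 2 * int N" "bl p = bl q" for p q
  proof -
    have "p \<le> q - int N"
      using init_window[OF pq(2) pq(6)] pq(4) by linarith
    moreover have "p \<noteq> q - int N"
      using pq(6) init_nonzero[OF pq(2)] bl_unshift[of q] by metis
    ultimately have "p - int N < q - 2 * int N" by simp
    moreover have "bl (q - 2 * int N) = bl p" using pq(6) bl_period(2)[of q] by simp
    ultimately have "p \<le> q - 2 * int N" using init_window[OF pq(1)] by blast
    then show False using pq by simp
  qed
  show "inj_on bl {q \<in> {0..<2 * int N}. init q}"
    by (rule linorder_inj_onI') (metis (no_types, lifting) atLeastLessThan_iff less mem_Collect_eq)
  show "bl ` {q \<in> {0..<2 * int N}. init q} = {V \<in> \<pi>. negset V \<noteq> V}"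
  proof (intro subset_antisym subsetI)
    fix V assume "V \<in> {V \<in> \<pi>. negset V \<noteq> V}"
    then have V: "V \<in> range bl" "negset V \<noteq> V" by (simp_all add: range_bl)
    then obtain y where y: "V = bl y" by blast
    obtain x where x: "0 \<le> x" "x < 2 * int N" "lab x = lab y" using lab_surj[OF lab_range] by metis
    then have "V = bl x" using y bl_cong by metis
    then obtain p where p: "init p" "p \<le> x" "x < p + int N" "bl p = V"
      using initial_exists[of x] V(2) by metis
    show "V \<in> bl ` {q \<in> {0..<2 * int N}. init q}"
    proof (cases "0 \<le> p")
      case True
      then show ?thesis using p x by auto
    next
      case False
      \<comment> \<open>The start found below \<open>x\<close> may precede the chosen turn; one full
        turn brings it back.\<close>
      have "init (p + 2 * int N)"
        using init_shift[of p] init_shift[of "p + int N"] p(1) by (simp add: add.assoc)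
      moreover have "bl (p + 2 * int N) = V" using p(4) bl_period(1)[of p] by simp
      moreover have "p + 2 * int N \<in> {0..<2 * int N}" using p x False by simp
      ultimately show ?thesis by (intro image_eqI[of _ _ "p + 2 * int N"]) simp_all
    qed
  next
    fix V assume "V \<in> bl ` {q \<in> {0..<2 * int N}. init q}"
    then obtain q where "V = bl q" "init q" by blast
    then show "V \<in> {V \<in> \<pi>. negset V \<noteq> V}" using bl_in[of q] init_nonzero[of q] by simp
  qed
qed

end

subsection \<open>Block statistics and counting\<close>

context nc_partition
begin

text \<open>Each pair of a non-zero block and its negative contributes once: their starts differ by
  \<open>N\<close>, so a half turn holds just one of them.\<close>

definition total :: nat where
  "total = (\<Sum>q\<in>{0..<int N}. wt q)"

lemma inj_bl: "init p \<Longrightarrow> init q \<Longrightarrow> bl p = bl q \<Longrightarrow>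
    p \<in> {0..<2 * int N} \<Longrightarrow> q \<in> {0..<2 * int N} \<Longrightarrow> p = q"
  using bij_betw_initial by (auto simp: bij_betw_def inj_on_def)

lemma nonzero_block:
  assumes "V \<in> \<pi>" "negset V \<noteq> V"
  obtains q where "q \<in> {0..<int N}" "init q" "bl q = V \<or> negset (bl q) = V" "wt q = card V"
proof -
  have "V \<in> bl ` {q \<in> {0..<2 * int N}. init q}"
    using bij_betw_initial assms by (simp add: bij_betw_def)
  then obtain q where q: "0 \<le> q" "q < 2 * int N" "init q" "bl q = V" by auto
  show ?thesis
  proof (cases "q < int N")
    case True
    then show ?thesis using q by (intro that[of q]) (simp_all add: weight_def)
  next
    case False
    have "init (q - int N)" using init_shift[of "q - int N"] q by simp
    then show ?thesis using False q
      by (intro that[of "q - int N"]) (simp_all add: weight_def bl_unshift card_negset)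
  qed
qed

lemma sum_double: "(\<Sum>q\<in>{0..<2 * int N}. wt q) = 2 * total"
proof -
  have "{0..<2 * int N} = {0..<int N} \<union> {int N..<2 * int N}" by auto
  then have "(\<Sum>q\<in>{0..<2 * int N}. wt q) = total + (\<Sum>q\<in>{int N..<2 * int N}. wt q)"
    unfolding total_def by (simp add: sum.union_disjoint ivl_disj_int)
  also have "(\<Sum>q\<in>{int N..<2 * int N}. wt q) = total"
    unfolding total_def
    by (rule sum.reindex_bij_witness[of _ "\<lambda>q. q + int N" "\<lambda>q. q - int N"])
      (use wt_periodic[of "_ - int N"] in \<open>auto simp: wt_periodic\<close>)
  finally show ?thesis by simp
qed

text \<open>All block sizes add up to \<open>2 * N\<close>, and the non-zero blocks account for the
  weights over a full turn. The zero-block, if present, is therefore twice the deficit of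
  \<open>total\<close>.\<close>

lemma zero_blocks_total: "2 * total + (\<Sum>V\<in>{V \<in> \<pi>. negset V = V}. card V) = 2 * N"
proof -
  have fin: "finite \<pi>" using finite_elements[OF finite_pmset part] .
  have "2 * total = (\<Sum>q\<in>{q \<in> {0..<2 * int N}. init q}. card (bl q))"
    unfolding sum_double[symmetric] weight_def by (subst sum.inter_filter) auto
  also have "\<dots> = (\<Sum>V\<in>{V \<in> \<pi>. negset V \<noteq> V}. card V)"
    by (rule sum.reindex_bij_betw[OF bij_betw_initial])
  finally have "2 * total + (\<Sum>V\<in>{V \<in> \<pi>. negset V = V}. card V) = (\<Sum>V\<in>\<pi>. card V)"
    using sum.Int_Diff[OF fin, of card "{V. negset V = V}"]
    by (simp add: Int_def set_diff_eq)
  also have "\<dots> = card (\<Union>\<pi>)"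
  proof (rule card_Union_disjoint[symmetric])
    show "pairwise disjnt \<pi>" using partition_onD2[OF part] by simp
    show "finite V" if "V \<in> \<pi>" for V
      using that partition_onD1[OF part] finite_subset[OF _ finite_pmset, of V] by blast
  qed
  also have "\<dots> = 2 * N" using partition_onD1[OF part] card_pmset by simp
  finally show ?thesis .
qed

lemma zero_blocks_cases:
  obtains "{V \<in> \<pi>. negset V = V} = {}" "total = N"
  | Z where "{V \<in> \<pi>. negset V = V} = {Z}" "2 * total + card Z = 2 * N"
proof -
  let ?Z = "{V \<in> \<pi>. negset V = V}"
  have "finite ?Z" using finite_elements[OF finite_pmset part] by simp
  moreover have "card ?Z \<le> 1" using nc by (simp add: NC_B_def)
  ultimately consider "card ?Z = 0" "finite ?Z" | "card ?Z = 1" by linarith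
  then show thesis
  proof cases
    case 1
    then have Z: "?Z = {}" by (simp only: card_0_eq)
    moreover have "total = N" using zero_blocks_total unfolding Z by simp
    ultimately show thesis by (rule that(1))
  next
    case 2
    then obtain Z where Z: "?Z = {Z}" by (rule card_1_singletonE)
    moreover have "2 * total + card Z = 2 * N" using zero_blocks_total unfolding Z by simp
    ultimately show thesis by (rule that(2))
  qed
qed

lemma total_le: "total \<le> N"
  using zero_blocks_total by simp

lemma zero_block_card_iff:
  assumes "0 < s"
  shows "(\<exists>V\<in>\<pi>. negset V = V \<and> card V = 2 * s) \<longleftrightarrow> total + s = N"
proof (cases rule: zero_blocks_cases)
  case 1
  have "(\<exists>V\<in>\<pi>. negset V = V \<and> card V = 2 * s) \<longleftrightarrow> (\<exists>V\<in>{V \<in> \<pi>. negset V = V}. card V = 2 * s)"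
    by blast
  \<comment> \<open>Without a zero-block \<open>total = N\<close>, so \<open>s > 0\<close> makes
    both sides false.\<close>
  then show ?thesis using assms 1(2) unfolding 1(1) by simp
next
  case (2 Z)
  have "(\<exists>V\<in>\<pi>. negset V = V \<and> card V = 2 * s) \<longleftrightarrow> (\<exists>V\<in>{V \<in> \<pi>. negset V = V}. card V = 2 * s)"
    by blast
  then have "(\<exists>V\<in>\<pi>. negset V = V \<and> card V = 2 * s) \<longleftrightarrow> card Z = 2 * s" unfolding 2(1) by simp
  then show ?thesis using 2(2) by auto
qed

text \<open>Non-zero blocks appear as weights; the size of the zero-block is
  \<open>2 * N - 2 * total\<close>, which inherits divisibility.\<close>

lemma dvd_card_iff:
  assumes "k dvd N"
  shows "(\<forall>V\<in>\<pi>. k dvd card V) \<longleftrightarrow> (\<forall>q\<in>{0..<int N}. k dvd wt q)"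
proof (intro iffI ballI)
  fix q assume "\<forall>V\<in>\<pi>. k dvd card V"
  then show "k dvd wt q" using bl_in[of q] by (simp add: weight_def)
next
  fix V assume wt: "\<forall>q\<in>{0..<int N}. k dvd wt q" and V: "V \<in> \<pi>"
  show "k dvd card V"
  proof (cases "negset V = V")
    case True
    have "2 * total + card V = 2 * N"
    proof (cases rule: zero_blocks_cases)
      case 1
      then show ?thesis using True V by blast
    next
      case (2 Z)
      then have "V = Z" using True V by blast
      then show ?thesis using 2(2) by simp
    qed
    moreover have "k dvd total" unfolding total_def using wt by (intro dvd_sum) auto
    ultimately show ?thesis using assms by (metis dvd_add_right_iff dvd_mult)
  next
    case False
    then show ?thesis using nonzero_block[OF V] wt by metis
  qed
qed

lemma card_pairs:
  assumes "0 < s"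
  shows "card {{V, negset V} | V. V \<in> \<pi> \<and> negset V \<noteq> V \<and> card V = s} = card {q \<in> {0..<int N}. wt q = s}"
proof -
  let ?P = "{{V, negset V} | V. V \<in> \<pi> \<and> negset V \<noteq> V \<and> card V = s}" and ?Q = "{q \<in> {0..<int N}. wt q = s}"
  \<comment> \<open>Since \<open>s > 0\<close>, a weight equal to \<open>s\<close> cannot be the
    default 0 of a position that starts no block.\<close>
  have Q: "init q \<and> card (bl q) = s" if "q \<in> ?Q" for q
    using that assms by (auto simp: weight_def split: if_splits)
  have "bij_betw (\<lambda>q. {bl q, negset (bl q)}) ?Q ?P"
  proof (rule bij_betw_imageI)
    show "inj_on (\<lambda>q. {bl q, negset (bl q)}) ?Q"
    proof (rule inj_onI)
      fix p q assume pq: "p \<in> ?Q" "q \<in> ?Q" "{bl p, negset (bl p)} = {bl q, negset (bl q)}"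
      then have "init p" "init q" "init (q + int N)" using Q by (simp_all add: init_shift)
      \<comment> \<open>Equal pairs allow \<open>p\<close> to start the same block as
        \<open>q\<close> or as \<open>q + int N\<close>. Starts are unique in a turn, and
        \<open>q + int N\<close> lies outside the half turn of \<open>p\<close>.\<close>
      moreover have "bl p = bl q \<or> bl p = bl (q + int N)" using pq(3) unfolding bl_shift by blast
      ultimately show "p = q" using inj_bl[of p q] inj_bl[of p "q + int N"] pq(1,2) by auto
    qed
    show "(\<lambda>q. {bl q, negset (bl q)}) ` ?Q = ?P"
    proof (intro subset_antisym subsetI)
      fix X assume "X \<in> (\<lambda>q. {bl q, negset (bl q)}) ` ?Q"
      then obtain q where "q \<in> ?Q" "X = {bl q, negset (bl q)}" by blast
      then show "X \<in> ?P" using Q[of q] bl_in[of q] init_nonzero[of q] by blast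
    next
      fix X assume "X \<in> ?P"
      then obtain V where V: "X = {V, negset V}" "V \<in> \<pi>" "negset V \<noteq> V" "card V = s" by blast
      obtain q where q: "q \<in> {0..<int N}" "init q" "bl q = V \<or> negset (bl q) = V" "wt q = card V"
        using V(2,3) by (rule nonzero_block)
      have "X = {bl q, negset (bl q)}" using q(3) unfolding V(1) by (metis insert_commute negset_negset)
      then show "X \<in> (\<lambda>q. {bl q, negset (bl q)}) ` ?Q"
        by (rule image_eqI) (use q V(4) in simp)
    qed
  qed
  then show ?thesis by (rule bij_betw_same_card[symmetric])
qed

lemma wt_mod: "wt (x mod int N) = wt x"
proof -
  have nat: "wt (y + int N * int i) = wt y" for y i
    using wt_periodic[of "y + int N * int _"] by (induction i) (simp_all add: algebra_simps)
  have "wt (x mod int N) = wt x" if "0 \<le> x div int N"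
    using nat[of "x mod int N" "nat (x div int N)"] that by simp
  moreover have "wt (x mod int N) = wt x" if "\<not> 0 \<le> x div int N"
  proof -
    have "x + int N * int (nat (- (x div int N))) = x mod int N"
      using that by (simp add: minus_mult_div_eq_mod)
    then show ?thesis using nat[of x "nat (- (x div int N))"] by simp
  qed
  ultimately show ?thesis by blast
qed

end

section \<open>From partitions to lists of naturals with bounded sum\<close>

lemma sum_int_interval: "(\<Sum>q\<in>{0..<int N}. f q) = (\<Sum>i<N. f (int i))"
  by (rule sum.reindex_bij_witness[of _ int nat]) auto

lemma sum_list_map_upt: "sum_list (map f [0..<N]) = (\<Sum>i<N. f i)"
  by (simp add: interv_sum_list_conv_sum_set_nat atLeast0LessThan)

lemma sum_list_nth_lessThan: "sum_list l = (\<Sum>i<length l. l ! i)"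
  by (simp add: sum_list_sum_nth atLeast0LessThan)

definition reduced_weights :: "nat \<Rightarrow> nat \<Rightarrow> int set set \<Rightarrow> nat list" where
  "reduced_weights k N \<pi> = map (\<lambda>i. weight N \<pi> (int i) div k) [0..<N]"

definition bounded_lists :: "nat \<Rightarrow> nat \<Rightarrow> nat list set" where
  "bounded_lists N n = {l. length l = N \<and> sum_list l \<le> n}"

definition stretch :: "nat \<Rightarrow> nat \<Rightarrow> nat list \<Rightarrow> int \<Rightarrow> nat" where
  "stretch k N l x = k * l ! nat (x mod int N)"

lemma finite_bounded_lists: "finite (bounded_lists N n)"
proof (rule finite_subset)
  show "bounded_lists N n \<subseteq> {l. set l \<subseteq> {..n} \<and> length l = N}"
    using member_le_sum_list by (fastforce simp: bounded_lists_def)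
  show "finite {l. set l \<subseteq> {..n} \<and> length l = N}"
    by (rule finite_lists_length_eq) simp
qed

lemma weight_dvd:
  assumes "0 < k" "0 < n" "\<pi> \<in> NC_Bk k n" "i < k * n"
  shows "k dvd weight (k * n) \<pi> (int i)"
proof -
  interpret nc_partition "k * n" \<pi> using assms by unfold_locales (auto simp: NC_Bk_def)
  have "int i \<in> {0..<int (k * n)}" using assms(4) by (simp del: of_nat_mult)
  moreover have "\<forall>V\<in>\<pi>. k dvd card V" using assms(3) by (simp add: NC_Bk_def)
  ultimately show ?thesis using dvd_card_iff[OF dvd_triv_left] by blast
qed

lemma weight_total:
  assumes "0 < k" "0 < n" "\<pi> \<in> NC_Bk k n"
  shows "nc_partition.total (k * n) \<pi> = k * sum_list (reduced_weights k (k * n) \<pi>)"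
proof -
  interpret nc_partition "k * n" \<pi> using assms by unfold_locales (auto simp: NC_Bk_def)
  have "total = (\<Sum>i<k * n. k * (wt (int i) div k))"
    unfolding total_def sum_int_interval
    by (rule sum.cong) (use weight_dvd[OF assms] in auto)
  then show ?thesis by (simp add: reduced_weights_def sum_list_map_upt sum_distrib_left)
qed

text \<open>Divisibility makes division by \<open>k\<close> lossless and periodicity lets one period
  determine all weights. The inverse extends a list periodically, multiplies by \<open>k\<close> and
  decodes.\<close>

lemma bij_betw_reduced_weights:
  assumes "0 < k" "0 < n"
  shows "bij_betw (reduced_weights k (k * n)) (NC_Bk k n) (bounded_lists (k * n) n)"
proof (rule bij_betw_byWitness)
  define N where "N = k * n"
  have N: "0 < N" using assms by (simp add: N_def)
  let ?inv = "\<lambda>l. blocks_of (k * n) (stretch k (k * n) l)"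
  show "\<forall>\<pi>\<in>NC_Bk k n. ?inv (reduced_weights k (k * n) \<pi>) = \<pi>"
  proof
    fix \<pi> assume \<pi>: "\<pi> \<in> NC_Bk k n"
    interpret nc_partition "k * n" \<pi> using assms \<pi> by unfold_locales (auto simp: NC_Bk_def)
    have "stretch k (k * n) (reduced_weights k (k * n) \<pi>) x = wt x" for x
    proof -
      define i where "i = nat (x mod int (k * n))"
      have "0 \<le> x mod int (k * n)" "x mod int (k * n) < int (k * n)"
        using N_pos by (simp_all del: of_nat_mult)
      then have i: "i < k * n" "int i = x mod int (k * n)" by (simp_all add: i_def nat_less_iff)
      have "stretch k (k * n) (reduced_weights k (k * n) \<pi>) x = k * (wt (int i) div k)"
        using i(1) unfolding stretch_def i_def[symmetric] by (simp add: reduced_weights_def)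
      also have "\<dots> = wt (int i)" using weight_dvd[OF assms \<pi> i(1)] by simp
      finally show ?thesis unfolding i(2) wt_mod .
    qed
    then have "stretch k (k * n) (reduced_weights k (k * n) \<pi>) = wt" ..
    then show "?inv (reduced_weights k (k * n) \<pi>) = \<pi>" using blocks_of_weight by simp
  qed
  show "reduced_weights k (k * n) ` NC_Bk k n \<subseteq> bounded_lists (k * n) n"
  proof (rule image_subsetI)
    fix \<pi> assume \<pi>: "\<pi> \<in> NC_Bk k n"
    interpret nc_partition "k * n" \<pi> using assms \<pi> by unfold_locales (auto simp: NC_Bk_def)
    have "k * sum_list (reduced_weights k (k * n) \<pi>) \<le> k * n"
      using total_le weight_total[OF assms \<pi>] by simp
    then show "reduced_weights k (k * n) \<pi> \<in> bounded_lists (k * n) n"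
      using assms by (simp add: bounded_lists_def) (simp add: reduced_weights_def)
  qed
  have weights: "weights N (stretch k N l)" if "l \<in> bounded_lists N n" for l
  proof unfold_locales
    show "stretch k N l (x + int N) = stretch k N l x" for x by (simp add: stretch_def)
    have "(\<Sum>i = 0..<int N. stretch k N l i) = (\<Sum>i<N. k * l ! i)"
      unfolding sum_int_interval by (rule sum.cong) (auto simp: stretch_def simp flip: of_nat_mod)
    also have "\<dots> = k * sum_list l"
      using that by (simp add: sum_list_nth_lessThan bounded_lists_def sum_distrib_left)
    also have "\<dots> \<le> N" using that by (simp add: N_def bounded_lists_def)
    finally show "(\<Sum>i = 0..<int N. stretch k N l i) \<le> N" .
  qed (rule N)
  show "\<forall>l\<in>bounded_lists (k * n) n. reduced_weights k (k * n) (?inv l) = l"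
  proof
    fix l assume l: "l \<in> bounded_lists (k * n) n"
    interpret weights "k * n" "stretch k (k * n) l" using weights l by (simp add: N_def)
    show "reduced_weights k (k * n) (?inv l) = l"
      by (rule nth_equalityI)
        (use l assms in \<open>auto simp: reduced_weights_def weight_blocks_of bounded_lists_def stretch_def simp flip: of_nat_mod of_nat_mult\<close>)
  qed
  show "?inv ` bounded_lists (k * n) n \<subseteq> NC_Bk k n"
  proof (rule image_subsetI)
    fix l assume l: "l \<in> bounded_lists (k * n) n"
    interpret weights "k * n" "stretch k (k * n) l" using weights l by (simp add: N_def)
    interpret nc_partition "k * n" "?inv l" using blocks_of_in_NC_B by unfold_locales
    have "\<forall>V\<in>?inv l. k dvd card V"
      by (subst dvd_card_iff) (simp_all add: weight_blocks_of stretch_def)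
    then show "?inv l \<in> NC_Bk k n" using blocks_of_in_NC_B by (simp add: NC_Bk_def)
  qed
qed

lemma zero_block_reduced:
  assumes "0 < k" "0 < n" "0 < t" "\<pi> \<in> NC_Bk k n"
  shows "(\<exists>V\<in>\<pi>. negset V = V \<and> card V = 2 * t * k) \<longleftrightarrow>
    sum_list (reduced_weights k (k * n) \<pi>) + t = n"
proof -
  interpret nc_partition "k * n" \<pi> using assms by unfold_locales (auto simp: NC_Bk_def)
  let ?s = "sum_list (reduced_weights k (k * n) \<pi>)"
  have "(\<exists>V\<in>\<pi>. negset V = V \<and> card V = 2 * t * k) \<longleftrightarrow> total + t * k = k * n"
    using zero_block_card_iff[of "t * k"] assms by (simp add: mult.assoc)
  also have "\<dots> \<longleftrightarrow> k * (?s + t) = k * n"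
    by (simp add: weight_total[OF assms(1,2,4)] algebra_simps)
  finally show ?thesis using assms by simp
qed

lemma card_pairs_reduced:
  assumes "0 < k" "0 < n" "0 < t" "\<pi> \<in> NC_Bk k n"
  shows "card {{V, negset V} | V. V \<in> \<pi> \<and> negset V \<noteq> V \<and> card V = t * k} =
    card {i. i < k * n \<and> reduced_weights k (k * n) \<pi> ! i = t}"
proof -
  interpret nc_partition "k * n" \<pi> using assms by unfold_locales (auto simp: NC_Bk_def)
  have wt: "wt (int i) = t * k \<longleftrightarrow> wt (int i) div k = t" if "i < k * n" for i
    using weight_dvd[OF assms(1,2,4) that] assms(1)
    by (metis dvd_div_mult_self nonzero_mult_div_cancel_right less_not_refl)
  have "{q \<in> {0..<int (k * n)}. wt q = t * k} = int ` {i. i < k * n \<and> wt (int i) div k = t}"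
  proof (intro subset_antisym subsetI)
    fix q assume q: "q \<in> {q \<in> {0..<int (k * n)}. wt q = t * k}"
    then obtain i where i: "q = int i" by (metis (no_types, lifting) atLeastLessThan_iff mem_Collect_eq nonneg_int_cases)
    then have "i < k * n" using q by (simp del: of_nat_mult)
    then show "q \<in> int ` {i. i < k * n \<and> wt (int i) div k = t}" using q i wt by simp
  next
    fix q assume "q \<in> int ` {i. i < k * n \<and> wt (int i) div k = t}"
    then obtain i where "q = int i" "i < k * n" "wt (int i) div k = t" by blast
    then show "q \<in> {q \<in> {0..<int (k * n)}. wt q = t * k}" using wt[of i] by (simp del: of_nat_mult)
  qed
  then have "card {q \<in> {0..<int (k * n)}. wt q = t * k} = card {i. i < k * n \<and> wt (int i) div k = t}"
    by (simp only: card_image inj_on_of_nat)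
  also have "{i. i < k * n \<and> wt (int i) div k = t} = {i. i < k * n \<and> reduced_weights k (k * n) \<pi> ! i = t}"
    by (auto simp: reduced_weights_def)
  finally show ?thesis using card_pairs[of "t * k"] assms by simp
qed

section \<open>Counting weak compositions\<close>

lemma card_lists_binomZ:
  assumes "0 < m" "0 < t"
  shows "card {l. length l = m \<and> sum_list l + t = n} = binomZ (int (n + m) - int t - 1) (int m - 1)"
proof (cases "t \<le> n")
  case True
  then have "{l. length l = m \<and> sum_list l + t = n} = {l. length l = m \<and> sum_list l = n - t}" by auto
  then have "card {l. length l = m \<and> sum_list l + t = n} = (n - t + m - 1) choose (n - t)"
    by (simp add: card_length_sum_list)
  also have "\<dots> = (n - t + m - 1) choose (m - 1)"
    using assms by (subst binomial_symmetric) auto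
  also have "\<dots> = binomZ (int (n + m) - int t - 1) (int m - 1)"
  proof -
    have "int (n + m) - int t - 1 = int (n - t + m - 1)" "int m - 1 = int (m - 1)"
      using assms True by auto
    then show ?thesis using True by (simp only: binomZ_def nat_int of_nat_0_le_iff of_nat_le_iff) simp
  qed
  finally show ?thesis .
next
  case False
  then have "{l. length l = m \<and> sum_list l + t = n} = {}" by auto
  \<comment> \<open>Here \<open>t > n\<close> puts the upper index below the lower one, so
    \<open>binomZ\<close> takes its default value 0.\<close>
  then show ?thesis using False by (simp add: binomZ_def)
qed

lemma sum_list_update_nat:
  "i < length l \<Longrightarrow> sum_list (l[i := x]) + l ! i = sum_list l + (x :: nat)"
  by (induction l arbitrary: i) (auto split: nat.split simp: nth_Cons)

text \<open>Trading the entry \<open>t\<close> for the slack changes the sum from \<open>S\<close>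
  to \<open>S - t + (n - S) = n - t\<close>. Writing \<open>t\<close> back is the inverse, because
  the overwritten slack is again \<open>n\<close> minus the restored sum.\<close>

lemma card_lists_fixed_entry:
  assumes "i < N"
  shows "card {l \<in> bounded_lists N n. l ! i = t} = card {l. length l = N \<and> sum_list l + t = n}"
proof -
  let ?f = "\<lambda>l. l[i := n - sum_list l]" and ?g = "\<lambda>l. l[i := t]"
  have f: "sum_list (?f l) + t = n" if "l \<in> bounded_lists N n" "l ! i = t" for l
    using sum_list_update_nat[of i l "n - sum_list l"] that assms by (simp add: bounded_lists_def)
  have g: "sum_list (?g l) + l ! i = n" if "length l = N" "sum_list l + t = n" for l
    using sum_list_update_nat[of i l t] that assms by simp
  have "bij_betw ?f {l \<in> bounded_lists N n. l ! i = t} {l. length l = N \<and> sum_list l + t = n}"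
  proof (rule bij_betw_byWitness[of _ ?g])
    show "\<forall>l\<in>{l \<in> bounded_lists N n. l ! i = t}. ?g (?f l) = l"
      by (auto simp: list_update_same_conv)
    show "?f ` {l \<in> bounded_lists N n. l ! i = t} \<subseteq> {l. length l = N \<and> sum_list l + t = n}"
      using f by (auto simp: bounded_lists_def)
    show "\<forall>l\<in>{l. length l = N \<and> sum_list l + t = n}. ?f (?g l) = l"
    proof
      fix l assume l: "l \<in> {l. length l = N \<and> sum_list l + t = n}"
      then have "n - sum_list (?g l) = l ! i" using g[of l] by simp
      then show "?f (?g l) = l" by simp
    qed
    show "?g ` {l. length l = N \<and> sum_list l + t = n} \<subseteq> {l \<in> bounded_lists N n. l ! i = t}"
    proof (rule image_subsetI)
      fix l assume l: "l \<in> {l. length l = N \<and> sum_list l + t = n}"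
      then show "?g l \<in> {l \<in> bounded_lists N n. l ! i = t}"
        using g[of l] assms by (simp add: bounded_lists_def)
    qed
  qed
  then show ?thesis by (rule bij_betw_same_card)
qed

theorem theorem2:
  fixes k n t :: nat
  assumes "k > 0" and "n > 0" and "t > 0"
  shows "((\<Sum>\<pi>\<in>NC_Bk k n. card {{V, negset V} | V. V \<in> \<pi> \<and> negset V \<noteq> V \<and> card V = t * k})
           = n * k * binomZ (int (n * (k + 1)) - int t - 1) (int (n * k) - 1)) \<and>
         (card {\<pi> \<in> NC_Bk k n. \<exists>V\<in>\<pi>. negset V = V \<and> card V = 2 * t * k}
           = binomZ (int (n * (k + 1)) - int t - 1) (int (n * k) - 1))"
proof
  let ?c = "reduced_weights k (k * n)" and ?L = "bounded_lists (k * n) n"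
  let ?S = "{l. length l = k * n \<and> sum_list l + t = n}"
  have bij: "bij_betw ?c (NC_Bk k n) ?L" using assms(1,2) by (rule bij_betw_reduced_weights)
  have S: "card ?S = binomZ (int (n * (k + 1)) - int t - 1) (int (n * k) - 1)"
    using card_lists_binomZ[of "k * n" t n] assms by (simp add: algebra_simps)
  have "(\<Sum>\<pi>\<in>NC_Bk k n. card {{V, negset V} | V. V \<in> \<pi> \<and> negset V \<noteq> V \<and> card V = t * k})
      = (\<Sum>\<pi>\<in>NC_Bk k n. card {i. i < k * n \<and> ?c \<pi> ! i = t})"
    by (rule sum.cong[OF refl], rule card_pairs_reduced) (use assms in auto)
  also have "\<dots> = (\<Sum>l\<in>?L. card {i. i < k * n \<and> l ! i = t})"
    by (rule sum.reindex_bij_betw[OF bij])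
  \<comment> \<open>Double counting: summing first over lists leaves, for each of the
    \<open>k * n\<close> positions, the same number \<open>card ?S\<close>.\<close>
  also have "\<dots> = (\<Sum>l\<in>?L. \<Sum>i<k * n. if l ! i = t then 1 else 0)"
    by (simp add: sum.If_cases Int_def)
  also have "\<dots> = (\<Sum>i<k * n. \<Sum>l\<in>?L. if l ! i = t then 1 else 0)"
    by (rule sum.swap)
  also have "\<dots> = (\<Sum>i<k * n. card {l \<in> ?L. l ! i = t})"
    by (simp add: sum.If_cases finite_bounded_lists Int_def)
  also have "\<dots> = (\<Sum>i<k * n. card ?S)"
    by (rule sum.cong) (simp_all add: card_lists_fixed_entry)
  finally show "(\<Sum>\<pi>\<in>NC_Bk k n. card {{V, negset V} | V. V \<in> \<pi> \<and> negset V \<noteq> V \<and> card V = t * k})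
           = n * k * binomZ (int (n * (k + 1)) - int t - 1) (int (n * k) - 1)"
    by (simp add: S mult.commute)
  have zero: "{\<pi> \<in> NC_Bk k n. \<exists>V\<in>\<pi>. negset V = V \<and> card V = 2 * t * k}
      = {\<pi> \<in> NC_Bk k n. sum_list (?c \<pi>) + t = n}"
    by (intro Collect_cong conj_cong refl) (rule zero_block_reduced[OF assms])
  have "bij_betw ?c {\<pi> \<in> NC_Bk k n. sum_list (?c \<pi>) + t = n} ?S"
  proof (rule bij_betw_subset[OF bij])
    have "?c ` {\<pi> \<in> NC_Bk k n. sum_list (?c \<pi>) + t = n} = {l \<in> ?c ` NC_Bk k n. sum_list l + t = n}"
      by blast
    \<comment> \<open>A list with \<open>sum_list l + t = n\<close> satisfies the bound of
      \<open>?L\<close>, so every member of \<open>?S\<close> is attained.\<close>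
    also have "\<dots> = ?S" unfolding bij_betw_imp_surj_on[OF bij] by (auto simp: bounded_lists_def)
    finally show "?c ` {\<pi> \<in> NC_Bk k n. sum_list (?c \<pi>) + t = n} = ?S" .
  qed blast
  then show "card {\<pi> \<in> NC_Bk k n. \<exists>V\<in>\<pi>. negset V = V \<and> card V = 2 * t * k}
           = binomZ (int (n * (k + 1)) - int t - 1) (int (n * k) - 1)"
    unfolding zero S[symmetric] by (rule bij_betw_same_card)
qed

end
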